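(* Let $\upsilon\ge1$ be an integer, $q>-1$ and $p$ real, and $s\ge0$ an integer with $s<\frac{p-1}{2}$. With $D_t=\partial/\partial t$, $D_w=\partial/\partial w$, for $t,w>0$ the polynomial $N={}_KN_{s;\upsilon}^{(p,q)}(t,w)$ satisfies $$\left[wD_w-\upsilon tD_t-w^{-q}D_w^{\upsilon}w^{q+1}D_w\right]N=0$$ and $$\left[\upsilon t\,(s-tD_t)(p-s-1-tD_t)-w^{-q}D_w^{\upsilon}w^{q+1}D_w\right]N=0 .$$
   Context: $(a)_n$ is the Pochhammer symbol. The first set of finite bivariate biorthogonal N-Konhauser polynomials is $${}_KN_{s;\upsilon}^{(p,q)}(t,w)=\Gamma(p-s)\sum_{k=0}^{s}\sum_{m=0}^{s-k}\frac{(-s)_{k+m}\,t^{s-k}w^{\upsilon m}}{\Gamma(p-2s+k)\,\Gamma(q+1+\upsilon m)\,k!\,m!}.$$ Products inside the brackets are compositions of operators (functions act by multiplication), e.g. $w^{-q}D_w^{\upsilon}w^{q+1}D_wN=w^{-q}\,\partial_w^{\upsilon}\!\left(w^{q+1}\partial_wN\right)$. *)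

theory Defs
  imports "HOL-Analysis.Analysis"
begin

(* The truncated subtraction in the exponent s - k is harmless because k ranges over {..s}. *)
definition N_Konhauser :: "nat \<Rightarrow> nat \<Rightarrow> real \<Rightarrow> real \<Rightarrow> real \<Rightarrow> real \<Rightarrow> real" where
  "N_Konhauser s \<upsilon> p q t w =
     Gamma (p - real s) *
     (\<Sum>k\<le>s. \<Sum>m\<le>s - k.
        pochhammer (- real s) (k + m) * t ^ (s - k) * w ^ (\<upsilon> * m) /
        (Gamma (p - 2 * real s + real k) * Gamma (q + 1 + real (\<upsilon> * m)) * fact k * fact m))"

text \<open>
  Differential operators act on functions of two real variables; products of operators are
  compositions.
\<close>

definition D_t :: "(real \<Rightarrow> real \<Rightarrow> real) \<Rightarrow> real \<Rightarrow> real \<Rightarrow> real" where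
  "D_t F = (\<lambda>t w. deriv (\<lambda>x. F x w) t)"

definition D_w :: "(real \<Rightarrow> real \<Rightarrow> real) \<Rightarrow> real \<Rightarrow> real \<Rightarrow> real" where
  "D_w F = (\<lambda>t w. deriv (\<lambda>y. F t y) w)"

definition mult_op :: "(real \<Rightarrow> real \<Rightarrow> real) \<Rightarrow> (real \<Rightarrow> real \<Rightarrow> real) \<Rightarrow> real \<Rightarrow> real \<Rightarrow> real" where
  "mult_op g F = (\<lambda>t w. g t w * F t w)"

text \<open>The operator \<open>c - t D_t\<close>, with \<open>c\<close> acting as multiplication by a constant.\<close>

definition euler_t :: "real \<Rightarrow> (real \<Rightarrow> real \<Rightarrow> real) \<Rightarrow> real \<Rightarrow> real \<Rightarrow> real" where
  "euler_t c F = (\<lambda>t w. c * F t w - t * D_t F t w)"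

text \<open>
  The operator \<open>w\<^sup>-\<^sup>q D_w\<^sup>\<upsilon> w\<^sup>q\<^sup>+\<^sup>1 D_w\<close>.  The real powers are only meaningful for \<open>w > 0\<close>;
  there the iterated derivative depends on positive arguments alone.
\<close>

definition konhauser_op :: "nat \<Rightarrow> real \<Rightarrow> (real \<Rightarrow> real \<Rightarrow> real) \<Rightarrow> real \<Rightarrow> real \<Rightarrow> real" where
  "konhauser_op \<upsilon> q =
     mult_op (\<lambda>t w. w powr (- q)) \<circ> (D_w ^^ \<upsilon>) \<circ> mult_op (\<lambda>t w. w powr (q + 1)) \<circ> D_w"

end

theory Submission
  imports Defs
begin

text \<open>
  On the monomials \<open>t ^ (s - k) * w ^ (\<upsilon> m)\<close> with \<open>k + m \<le> s\<close>, each of the three operators in the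
  theorem is either diagonal or a weighted shift.  Writing \<open>1 / \<Gamma>\<close> as \<open>rGamma\<close>, the coefficient
  of such a monomial in \<open>N\<close> is \<open>a k m * rGamma (q + 1 + \<upsilon> m)\<close>, where \<open>a\<close> (the function
  \<open>N_coeff\<close>) obeys one recurrence in each direction: \<open>(m + 1) a k (m + 1)\<close> and
  \<open>(k + 1) (p - 2 s + k) a (k + 1) m\<close> both equal \<open>(k + m - s) a k m\<close>
  (\<open>N_coeff_Suc_snd\<close>, \<open>N_coeff_Suc_fst\<close>).

  The operator \<open>w D_w - \<upsilon> t D_t\<close> multiplies the monomial by \<open>\<upsilon> (k + m - s)\<close>.
  The Konhauser operator lowers \<open>m\<close> by one; its weight is \<open>\<upsilon> m\<close> times a ratio of Gamma values that
  moves \<open>rGamma\<close> from \<open>q + 1 + \<upsilon> m\<close> to \<open>q + 1 + \<upsilon> (m - 1)\<close> (\<open>konhauser_op_monomial_sum\<close>).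
  The operator \<open>\<upsilon> t (s - t D_t) (p - s - 1 - t D_t)\<close> lowers \<open>k\<close> by one, with weight
  \<open>\<upsilon> k (p - 2 s + k - 1)\<close>.  By the two recurrences, each of them sends \<open>N\<close> to the same polynomial,
  in which the monomial has the coefficient \<open>\<upsilon> (k + m - s) a k m * rGamma (q + 1 + \<upsilon> m)\<close>, and both
  equations follow.  The factor \<open>k + m - s\<close> vanishes on the edge \<open>k + m = s\<close>, which is exactly
  the part of the triangle that the shifts do not reach.
\<close>

section \<open>Differential operators on finite sums of monomials\<close>

definition monomial_sum ::
  "'i set \<Rightarrow> ('i \<Rightarrow> real) \<Rightarrow> ('i \<Rightarrow> nat) \<Rightarrow> ('i \<Rightarrow> nat) \<Rightarrow> real \<Rightarrow> real \<Rightarrow> real" where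
  "monomial_sum I c e f t w = (\<Sum>i\<in>I. c i * t ^ e i * w ^ f i)"

lemma D_t_monomial_sum:
  "D_t (monomial_sum I c e f) t w = (\<Sum>i\<in>I. c i * (real (e i) * t ^ (e i - 1)) * w ^ f i)"
  unfolding D_t_def monomial_sum_def
  by (rule DERIV_imp_deriv) (auto intro!: derivative_eq_intros sum.cong)

lemma D_w_monomial_sum:
  "D_w (monomial_sum I c e f) t w = (\<Sum>i\<in>I. c i * t ^ e i * (real (f i) * w ^ (f i - 1)))"
  unfolding D_w_def monomial_sum_def
  by (rule DERIV_imp_deriv) (auto intro!: derivative_eq_intros sum.cong)

lemma real_times_power_pred: "x * (real n * x ^ (n - 1)) = real n * (x::real) ^ n"
  by (cases n) simp_all

lemma t_D_t_monomial_sum: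
  "t * D_t (monomial_sum I c e f) t w = monomial_sum I (\<lambda>i. real (e i) * c i) e f t w"
proof -
  have "t * (c i * (real (e i) * t ^ (e i - 1)) * w ^ f i) = real (e i) * c i * t ^ e i * w ^ f i"
    for i
    using arg_cong[OF real_times_power_pred[of t "e i"], of "\<lambda>x. c i * x * w ^ f i"]
    by (simp add: mult_ac)
  then show ?thesis
    by (simp only: D_t_monomial_sum monomial_sum_def sum_distrib_left)
qed

lemma w_D_w_monomial_sum:
  "w * D_w (monomial_sum I c e f) t w = monomial_sum I (\<lambda>i. real (f i) * c i) e f t w"
proof -
  have "w * (c i * t ^ e i * (real (f i) * w ^ (f i - 1))) = real (f i) * c i * t ^ e i * w ^ f i"
    for i
    using arg_cong[OF real_times_power_pred[of w "f i"], of "\<lambda>x. c i * t ^ e i * x"]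
    by (simp add: mult_ac)
  then show ?thesis
    by (simp only: D_w_monomial_sum monomial_sum_def sum_distrib_left)
qed

lemma euler_t_monomial_sum:
  "euler_t b (monomial_sum I c e f) = monomial_sum I (\<lambda>i. (b - real (e i)) * c i) e f"
  unfolding euler_t_def t_D_t_monomial_sum
  by (intro ext)
    (simp add: monomial_sum_def sum_distrib_left sum_subtractf[symmetric] algebra_simps)

text \<open>
  The normalised power \<open>rGamma (a + 1) * w powr a\<close> differentiates to the one with \<open>a - 1\<close> in place
  of \<open>a\<close>, for every real \<open>a\<close>: at a pole of \<open>Gamma\<close>, \<open>rGamma\<close> is zero, so no exponent is exceptional.
  Differentiating \<open>n\<close> times thus only subtracts \<open>n\<close> from each exponent.
\<close>

lemma D_w_iter_normalised_powr_sum: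
  assumes F: "\<And>w. w > 0 \<Longrightarrow> F t w = (\<Sum>i\<in>I. c i * (rGamma (a i + 1) * w powr a i))"
    and "w > 0"
  shows "(D_w ^^ n) F t w = (\<Sum>i\<in>I. c i * (rGamma (a i - real n + 1) * w powr (a i - real n)))"
  using \<open>w > 0\<close>
proof (induction n arbitrary: w)
  case 0
  then show ?case by (simp add: F)
next
  case (Suc n)
  let ?S = "\<lambda>n w. \<Sum>i\<in>I. c i * (rGamma (a i - real n + 1) * w powr (a i - real n))"
  \<comment> \<open>The formula for the \<open>n\<close>-th derivative is known only for positive arguments, which suffices
      because they form a neighbourhood of \<open>w\<close>.\<close>
  have "eventually (\<lambda>y. (D_w ^^ n) F t y = ?S n y) (nhds w)"
    using eventually_nhds_in_open[of "{0<..}" w] Suc.prems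
    by (auto elim!: eventually_mono intro: Suc.IH)
  then have "(D_w ^^ Suc n) F t w = deriv (?S n) w"
    by (simp add: D_w_def deriv_cong_ev)
  also have "\<dots> = ?S (Suc n) w"
  proof (rule DERIV_imp_deriv)
    have "((\<lambda>y. c i * (rGamma (a i - real n + 1) * y powr (a i - real n))) has_field_derivative
        c i * (rGamma (a i - real (Suc n) + 1) * w powr (a i - real (Suc n)))) (at w)" for i
    proof -
      have "((\<lambda>y. c i * (rGamma (a i - real n + 1) * y powr (a i - real n))) has_field_derivative
          c i * (rGamma (a i - real n + 1) * ((a i - real n) * w powr (a i - real n - 1)))) (at w)"
        using Suc.prems by (intro DERIV_cmult has_real_derivative_powr)
      also have "rGamma (a i - real n + 1) * ((a i - real n) * w powr (a i - real n - 1)) =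
          rGamma (a i - real (Suc n) + 1) * w powr (a i - real (Suc n))"
        unfolding mult.assoc[symmetric] mult.commute[of "rGamma _" "a i - real n"] rGamma_plus1
        by (simp add: algebra_simps)
      finally show ?thesis .
    qed
    then show "(?S n has_field_derivative ?S (Suc n) w) (at w)"
      by (rule DERIV_sum)
  qed
  finally show ?case .
qed

text \<open>
  The factor \<open>w powr (q + 1)\<close> turns the derivative of \<open>w ^ f i\<close> into \<open>f i * w powr (q + f i)\<close>, and
  the factor \<open>rGamma (q + 1 + f i)\<close> in the coefficient is the one that normalises this power.
  Summands constant in \<open>w\<close> fit the same formula: for \<open>f i = 0\<close> both sides of it are zero, whatever
  the exponent says.
\<close>

lemma konhauser_op_monomial_sum:
  assumes "w > 0"
  shows "konhauser_op n q (monomial_sum I (\<lambda>i. c i * rGamma (q + 1 + real (f i))) e f) t w =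
    (\<Sum>i\<in>I. real (f i) * c i * t ^ e i *
      (rGamma (q + 1 + real (f i) - real n) * w powr (real (f i) - real n)))"
proof -
  let ?N = "monomial_sum I (\<lambda>i. c i * rGamma (q + 1 + real (f i))) e f"
  let ?F = "mult_op (\<lambda>t w. w powr (q + 1)) (D_w ?N)"
  have F: "?F t y = (\<Sum>i\<in>I. real (f i) * c i * t ^ e i *
      (rGamma (q + real (f i) + 1) * y powr (q + real (f i))))" if "y > 0" for y
  proof -
    have powr: "y powr (q + 1) * (real (f i) * y ^ (f i - 1)) = real (f i) * y powr (q + real (f i))"
      for i
    proof -
      have "y powr (q + 1) * (real (f i) * y ^ (f i - 1)) =
          y powr q * (y * (real (f i) * y ^ (f i - 1)))"
        using that by (simp add: powr_add)
      also have "\<dots> = real (f i) * y powr (q + real (f i))"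
        unfolding real_times_power_pred using that by (simp add: powr_add powr_realpow)
      finally show ?thesis .
    qed
    have "y powr (q + 1) * (c i * rGamma (q + 1 + real (f i)) * t ^ e i *
          (real (f i) * y ^ (f i - 1))) =
        real (f i) * c i * t ^ e i * (rGamma (q + real (f i) + 1) * y powr (q + real (f i)))" for i
      using arg_cong[OF powr[of i], of "\<lambda>x. c i * rGamma (q + 1 + real (f i)) * t ^ e i * x"]
      by (simp only: add_ac mult_ac)
    then show ?thesis
      by (simp only: mult_op_def D_w_monomial_sum sum_distrib_left)
  qed
  have "konhauser_op n q ?N t w = w powr (- q) * (D_w ^^ n) ?F t w"
    by (simp add: konhauser_op_def mult_op_def)
  also have "\<dots> = w powr (- q) * (\<Sum>i\<in>I. real (f i) * c i * t ^ e i *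
      (rGamma (q + real (f i) - real n + 1) * w powr (q + real (f i) - real n)))"
    by (simp only: D_w_iter_normalised_powr_sum[where F = ?F and I = I and a = "\<lambda>i. q + real (f i)"
          and c = "\<lambda>i. real (f i) * c i * t ^ e i", OF F assms])
  also have "\<dots> = (\<Sum>i\<in>I. real (f i) * c i * t ^ e i *
      (rGamma (q + 1 + real (f i) - real n) * w powr (real (f i) - real n)))"
    unfolding sum_distrib_left
  proof (rule sum.cong[OF refl])
    fix i
    have powr: "w powr (- q) * w powr (q + real (f i) - real n) = w powr (real (f i) - real n)"
      by (simp add: powr_add[symmetric])
    have gamma_arg: "q + real (f i) - real n + 1 = q + 1 + real (f i) - real n"
      by simp
    show "w powr (- q) * (real (f i) * c i * t ^ e i *
        (rGamma (q + real (f i) - real n + 1) * w powr (q + real (f i) - real n))) =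
      real (f i) * c i * t ^ e i *
        (rGamma (q + 1 + real (f i) - real n) * w powr (real (f i) - real n))"
      unfolding gamma_arg powr[symmetric] by (simp only: mult_ac)
  qed
  finally show ?thesis .
qed

section \<open>The coefficients of the N-Konhauser polynomials\<close>

definition triangle :: "nat \<Rightarrow> (nat \<times> nat) set" where
  "triangle s = (SIGMA k:{..s}. {..s - k})"

lemma mem_triangle [simp]: "(k, m) \<in> triangle s \<longleftrightarrow> k + m \<le> s"
  by (auto simp: triangle_def)

lemma finite_triangle [simp]: "finite (triangle s)"
  by (simp add: triangle_def)

text \<open>
  A sum over the triangle may be shifted when the summand vanishes on the edge that the shift
  drops and the shifted summand vanishes on the edge \<open>k + m = s\<close> that it opens.
\<close>

lemma sum_triangle_shift_snd:
  fixes h g :: "nat \<times> nat \<Rightarrow> real"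
  assumes "\<And>k. h (k, 0) = 0" and "\<And>k m. k + m = s \<Longrightarrow> g (k, m) = 0"
    and "\<And>k m. k + m < s \<Longrightarrow> h (k, Suc m) = g (k, m)"
  shows "sum h (triangle s) = sum g (triangle s)"
proof -
  have "0 < m" if "h (k, m) \<noteq> 0" for k m
    using that assms(1) by (cases m) auto
  then have "sum h (triangle s) = sum h {(k, m) \<in> triangle s. 0 < m}"
    by (intro sum.mono_neutral_right) auto
  also have "\<dots> = sum g {(k, m). k + m < s}"
    by (rule sum.reindex_bij_witness[where i = "\<lambda>(k, m). (k, Suc m)" and
          j = "\<lambda>(k, m). (k, m - 1)"]) (auto simp: assms(3)[symmetric])
  also have "\<dots> = sum g (triangle s)"
  proof (rule sum.mono_neutral_left)
    show "\<forall>x\<in>triangle s - {(k, m). k + m < s}. g x = 0"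
      by (auto intro!: assms(2))
  qed auto
  finally show ?thesis .
qed

lemma sum_triangle_shift_fst:
  fixes h g :: "nat \<times> nat \<Rightarrow> real"
  assumes "\<And>m. h (0, m) = 0" and "\<And>k m. k + m = s \<Longrightarrow> g (k, m) = 0"
    and "\<And>k m. k + m < s \<Longrightarrow> h (Suc k, m) = g (k, m)"
  shows "sum h (triangle s) = sum g (triangle s)"
proof -
  have swap: "sum f (triangle s) = (\<Sum>x\<in>triangle s. f (prod.swap x))" for f :: "nat \<times> nat \<Rightarrow> real"
    by (rule sum.reindex_bij_witness[where i = prod.swap and j = prod.swap]) auto
  show ?thesis
    unfolding swap[of h] swap[of g]
    by (rule sum_triangle_shift_snd) (use assms in \<open>auto simp: add.commute\<close>)
qed

text \<open>
  The factor \<open>rGamma (q + 1 + \<upsilon> m)\<close> is left out of the coefficient: it is the normalisation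
  on which the Konhauser operator acts, and \<open>q\<close> and \<open>\<upsilon>\<close> do not enter the recurrences of the rest.
\<close>

definition N_coeff :: "nat \<Rightarrow> real \<Rightarrow> nat \<times> nat \<Rightarrow> real" where
  "N_coeff s p = (\<lambda>(k, m). Gamma (p - real s) * pochhammer (- real s) (k + m) *
     rGamma (p - 2 * real s + real k) / (fact k * fact m))"

lemma N_Konhauser_eq_monomial_sum:
  "N_Konhauser s \<upsilon> p q = monomial_sum (triangle s)
     (\<lambda>i. N_coeff s p i * rGamma (q + 1 + real (\<upsilon> * snd i))) (\<lambda>i. s - fst i) (\<lambda>i. \<upsilon> * snd i)"
  unfolding N_Konhauser_def monomial_sum_def triangle_def N_coeff_def
  by (intro ext)
    (simp add: sum.Sigma sum_distrib_left rGamma_inverse_Gamma split_def field_simps)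

lemma N_coeff_Suc_snd:
  "real (Suc m) * N_coeff s p (k, Suc m) = (real k + real m - real s) * N_coeff s p (k, m)"
  by (simp add: N_coeff_def pochhammer_Suc field_simps del: of_nat_Suc)

lemma N_coeff_Suc_fst:
  "real (Suc k) * (p - 2 * real s + real k) * N_coeff s p (Suc k, m) =
     (real k + real m - real s) * N_coeff s p (k, m)"
proof -
  have r: "rGamma (p - 2 * real s + real k) =
      (p - 2 * real s + real k) * rGamma (p - 2 * real s + real (Suc k))"
    using rGamma_plus1[of "p - 2 * real s + real k"] by (simp add: add_ac)
  show ?thesis
    unfolding N_coeff_def prod.case r
    by (simp add: pochhammer_Suc field_simps del: of_nat_Suc)
qed

section \<open>The differential equations\<close>

text \<open>
  The common image of \<open>N\<close>, up to the factor \<open>\<upsilon>\<close>, under the three operators.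
\<close>

definition N_image :: "nat \<Rightarrow> nat \<Rightarrow> real \<Rightarrow> real \<Rightarrow> real \<Rightarrow> real \<Rightarrow> real" where
  "N_image s \<upsilon> p q = monomial_sum (triangle s)
     (\<lambda>i. (real (fst i) + real (snd i) - real s) * N_coeff s p i *
        rGamma (q + 1 + real (\<upsilon> * snd i)))
     (\<lambda>i. s - fst i) (\<lambda>i. \<upsilon> * snd i)"

lemma homogeneity_op_N_Konhauser:
  "w * D_w (N_Konhauser s \<upsilon> p q) t w - real \<upsilon> * (t * D_t (N_Konhauser s \<upsilon> p q) t w) =
     real \<upsilon> * N_image s \<upsilon> p q t w"
  unfolding N_Konhauser_eq_monomial_sum w_D_w_monomial_sum t_D_t_monomial_sum N_image_def
    monomial_sum_def sum_distrib_left sum_subtractf[symmetric]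
  by (rule sum.cong) (auto simp: of_nat_diff algebra_simps)

lemma konhauser_op_N_Konhauser:
  assumes "w > 0"
  shows "konhauser_op \<upsilon> q (N_Konhauser s \<upsilon> p q) t w = real \<upsilon> * N_image s \<upsilon> p q t w"
  unfolding N_Konhauser_eq_monomial_sum konhauser_op_monomial_sum[OF assms] N_image_def
    monomial_sum_def sum_distrib_left
proof (rule sum_triangle_shift_snd, goal_cases)
  case (3 k m)
  have exponent: "real (\<upsilon> * Suc m) - real \<upsilon> = real (\<upsilon> * m)"
    by (simp add: algebra_simps)
  have powr: "w powr (real (\<upsilon> * Suc m) - real \<upsilon>) = w ^ (\<upsilon> * m)"
    unfolding exponent by (rule powr_realpow[OF assms])
  have rGamma: "rGamma (q + 1 + real (\<upsilon> * Suc m) - real \<upsilon>) = rGamma (q + 1 + real (\<upsilon> * m))"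
    unfolding exponent[symmetric] by (simp only: add_diff_eq)
  have coeff: "real (\<upsilon> * Suc m) * N_coeff s p (k, Suc m) =
      real \<upsilon> * ((real k + real m - real s) * N_coeff s p (k, m))"
    unfolding N_coeff_Suc_snd[symmetric] by (simp add: algebra_simps)
  show ?case
    unfolding prod.sel powr rGamma coeff by (simp only: mult_ac)
qed auto

lemma euler_t_op_N_Konhauser:
  "t * (euler_t (real s) \<circ> euler_t (p - real s - 1)) (N_Konhauser s \<upsilon> p q) t w =
     N_image s \<upsilon> p q t w"
  unfolding N_Konhauser_eq_monomial_sum o_apply euler_t_monomial_sum N_image_def
    monomial_sum_def sum_distrib_left
proof (rule sum_triangle_shift_fst, goal_cases)
  case (3 k m)
  have "t * t ^ (s - Suc k) = t ^ (s - k)"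
    using 3 by (simp add: power_Suc[symmetric] Suc_diff_Suc del: power_Suc)
  moreover have "(real s - real (s - Suc k)) * (p - real s - 1 - real (s - Suc k)) *
      N_coeff s p (Suc k, m) = (real k + real m - real s) * N_coeff s p (k, m)"
    using 3 unfolding N_coeff_Suc_fst[symmetric] by (simp add: of_nat_diff algebra_simps)
  ultimately show ?case by (simp add: mult_ac)
qed auto

theorem theorem23:
  fixes \<upsilon> s :: nat and p q t w :: real
  assumes "\<upsilon> \<ge> 1" and "q > -1" and "real s < (p - 1) / 2"
    and "t > 0" and "w > 0"
  defines "N \<equiv> N_Konhauser s \<upsilon> p q"
  shows "w * D_w N t w - real \<upsilon> * t * D_t N t w - konhauser_op \<upsilon> q N t w = 0
    \<and> real \<upsilon> * t * (euler_t (real s) \<circ> euler_t (p - real s - 1)) N t w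
        - konhauser_op \<upsilon> q N t w = 0"
  unfolding N_def mult.assoc homogeneity_op_N_Konhauser euler_t_op_N_Konhauser
    konhauser_op_N_Konhauser[OF \<open>w > 0\<close>]
  by simp

end
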